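(* Let $n\ge 4$ be an even integer. In both the open and the closed game of $1\times n$ Dots-and-Boxes (as defined in the context), the first player has a strategy guaranteeing at least a tie, i.e. guaranteeing that at the end of the game she has claimed at least as many boxes as her opponent, whatever the opponent does.
   Context: The $1\times n$ Dots-and-Boxes board consists of two rows of $n+1$ dots each: bottom dots $b_0,\dots,b_n$ and top dots $t_0,\dots,t_n$, placed at the points of a $2\times(n+1)$ unit grid. The possible edges are the horizontal unit segments $b_{i-1}b_i$ and $t_{i-1}t_i$ ($1\le i\le n$) and the vertical unit segments $b_it_i$ ($0\le i\le n$). The boxes (faces) are the $n$ unit squares $b_{i-1}b_it_it_{i-1}$, $1\le i\le n$. In the open version no edges are drawn at the start. In the closed version, all top edges $t_{i-1}t_i$ ($1\le i\le n$) and the two side edges $b_0t_0$ and $b_nt_n$ are already drawn at the start, and all other edges are undrawn. Two players alternate turns; on a move a player draws one currently undrawn edge. If drawing that edge completes one or more boxes (all four sides drawn), the player claims those boxes and must immediately move again (if any undrawn edge remains); otherwise the turn passes to the other player. The game ends when all edges are drawn (equivalently all boxes claimed); the player who has claimed more boxes wins, and equal numbers is a tie. *)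

theory Defs
  imports Main
begin

text \<open>Edges of the 1 x n Dots-and-Boxes board: bottom edge b_{i-1}b_i is BotE i,
top edge t_{i-1}t_i is TopE i (1 <= i <= n), vertical edge b_i t_i is VertE i (0 <= i <= n).\<close>
datatype edge = BotE nat | TopE nat | VertE nat

definition board_edges :: "nat \<Rightarrow> edge set" where
  "board_edges n = BotE ` {1..n} \<union> TopE ` {1..n} \<union> VertE ` {0..n}"

definition box_sides :: "nat \<Rightarrow> edge set" where
  "box_sides i = {BotE i, TopE i, VertE (i - 1), VertE i}"

definition completed :: "nat \<Rightarrow> edge set \<Rightarrow> edge \<Rightarrow> nat" where
  "completed n D e = card {i \<in> {1..n}. e \<in> box_sides i \<and> box_sides i \<subseteq> insert e D}"

text \<open>first_can_force n D s p: from the position with drawn edges D, where s is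
(boxes of first player) - (boxes of second player) so far, and p = True iff it is the
first player's turn, the first player has a strategy guaranteeing that at the end
of the game the final difference is >= 0, whatever the opponent does.
A player completing at least one box moves again; otherwise the turn passes.\<close>
inductive first_can_force :: "nat \<Rightarrow> edge set \<Rightarrow> int \<Rightarrow> bool \<Rightarrow> bool" for n where
  game_over: "D = board_edges n \<Longrightarrow> s \<ge> 0 \<Longrightarrow> first_can_force n D s p"
| first_moves: "e \<in> board_edges n - D \<Longrightarrow>
     first_can_force n (insert e D) (s + int (completed n D e)) (completed n D e > 0)
     \<Longrightarrow> first_can_force n D s True"
| second_moves: "board_edges n - D \<noteq> {} \<Longrightarrow>
     (\<forall>e \<in> board_edges n - D.
        first_can_force n (insert e D) (s - int (completed n D e)) (completed n D e = 0))
     \<Longrightarrow> first_can_force n D s False"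

definition open_start :: "nat \<Rightarrow> edge set" where
  "open_start n = {}"

definition closed_start :: "nat \<Rightarrow> edge set" where
  "closed_start n = TopE ` {1..n} \<union> {VertE 0, VertE n}"

end

theory Submission
  imports Defs
begin

text \<open>
  The first player draws the middle vertical edge, which leaves a mirror-symmetric position in which
  no box can be captured; such a position is worth at most 0 to the player who must move in it.
  Suppose that player draws \<open>e\<close>. If some box is now capturable by an edge \<open>f\<close> that leads to a box
  with exactly two undrawn sides \<open>f\<close> and \<open>g\<close>, the opponent may either draw \<open>f\<close> and \<open>g\<close>, gaining 2
  and moving on, or draw \<open>g\<close> only, conceding 2 and forcing the other player to move on. The two
  outcomes are opposite numbers, so one of them is nonnegative. Otherwise the opponent captures
  everything and draws the mirror image of \<open>e\<close>. The only captures then on offer are the mirror images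
  of those just made, and behind them lies a smaller symmetric position without capturable boxes.
\<close>

lemma card_2_other:
  assumes "card X = 2" "a \<in> X"
  obtains b where "X = {a, b}" "a \<noteq> b"
  using assms by (metis card_2_iff doubleton_eq_iff insertE singletonD)

section \<open>The value of a position\<close>

text \<open>A position is given by its set \<open>U\<close> of undrawn edges, and \<open>val U\<close> is the lead over the
  other player that the player to move can force from there on.\<close>

locale box_game =
  fixes I :: "'b set" and B :: "'b \<Rightarrow> 'a set"
  assumes finite_boxes: "finite I"
begin

definition score :: "'a set \<Rightarrow> 'a \<Rightarrow> nat" where
  "score U e = card {i \<in> I. B i \<inter> U = {e}}"

function val :: "'a set \<Rightarrow> int" where
  "val U = (if finite U \<and> U \<noteq> {}
     then Max ((\<lambda>e. if score U e > 0 then int (score U e) + val (U - {e}) else - val (U - {e})) ` U)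
     else 0)"
  by auto
termination
  by (relation "measure card") (auto simp: card_gt_0_iff)

declare val.simps [simp del]

lemma val_empty [simp]: "val {} = 0"
  by (simp add: val.simps)

lemma score_eq_0_iff: "score U e = 0 \<longleftrightarrow> (\<forall>i\<in>I. B i \<inter> U \<noteq> {e})"
  using finite_boxes by (auto simp: score_def)

lemma score_pos_iff: "score U e > 0 \<longleftrightarrow> (\<exists>i\<in>I. B i \<inter> U = {e})"
  using score_eq_0_iff[of U e] by (metis neq0_conv)

section \<open>Bounds on the value from single moves and runs of captures\<close>

lemma val_ge_capture:
  assumes "finite U" "e \<in> U" "score U e > 0"
  shows "val U \<ge> int (score U e) + val (U - {e})"
proof -
  have "val U = Max ((\<lambda>e. if score U e > 0 then int (score U e) + val (U - {e})
      else - val (U - {e})) ` U)"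
    using assms by (subst val.simps) auto
  also have "\<dots> \<ge> (if score U e > 0 then int (score U e) + val (U - {e}) else - val (U - {e}))"
    using assms by (intro Max_ge) auto
  finally show ?thesis using assms by simp
qed

lemma val_ge_pass:
  assumes "finite U" "e \<in> U" "score U e = 0"
  shows "val U \<ge> - val (U - {e})"
proof -
  have "val U = Max ((\<lambda>e. if score U e > 0 then int (score U e) + val (U - {e})
      else - val (U - {e})) ` U)"
    using assms by (subst val.simps) auto
  also have "\<dots> \<ge> (if score U e > 0 then int (score U e) + val (U - {e}) else - val (U - {e}))"
    using assms by (intro Max_ge) auto
  finally show ?thesis using assms by simp
qed

lemma val_attained:
  assumes "finite U" "U \<noteq> {}"
  obtains e where "e \<in> U" "score U e > 0" "val U = int (score U e) + val (U - {e})"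
    | e where "e \<in> U" "score U e = 0" "val U = - val (U - {e})"
proof -
  have "val U = Max ((\<lambda>e. if score U e > 0 then int (score U e) + val (U - {e})
      else - val (U - {e})) ` U)"
    using assms by (subst val.simps) auto
  also have "\<dots> \<in> (\<lambda>e. if score U e > 0 then int (score U e) + val (U - {e})
      else - val (U - {e})) ` U"
    using assms by (intro Max_in) auto
  finally show ?thesis using that by (auto split: if_splits)
qed

text \<open>Different edges of \<open>F\<close> are last sides of different boxes, so drawing one of
  them keeps the turn and leaves the others capturable. Each edge is counted for one box although it
  may complete several, hence only a bound.\<close>

lemma val_ge_captures:
  assumes "finite F" "finite U" "F \<subseteq> U" "\<And>f. f \<in> F \<Longrightarrow> \<exists>i\<in>I. B i \<inter> U = {f}"
  shows "val U \<ge> int (card F) + val (U - F)"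
  using assms
proof (induction F arbitrary: U rule: finite_induct)
  case empty
  then show ?case by simp
next
  case (insert f F)
  have "score U f > 0" using insert.prems by (auto simp: score_pos_iff)
  then have "val U \<ge> 1 + val (U - {f})"
    using val_ge_capture[of U f] insert.prems by auto
  moreover have "val (U - {f}) \<ge> int (card F) + val (U - {f} - F)"
  proof (rule insert.IH)
    fix h assume h: "h \<in> F"
    then obtain i where "i \<in> I" "B i \<inter> U = {h}" using insert.prems by blast
    moreover have "h \<noteq> f" using h insert.hyps by blast
    ultimately show "\<exists>i\<in>I. B i \<inter> (U - {f}) = {h}" by blast
  qed (use insert in auto)
  moreover have "U - {f} - F = U - insert f F" by blast
  ultimately show ?case using insert.hyps by simp
qed

text \<open>Capturing \<open>f\<close> at once loses nothing, because \<open>f\<close> interacts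
  with no other move. A best move \<open>e \<noteq> f\<close> in \<open>U\<close> can be made in
  \<open>U - {f}\<close> with the same score; the gain from \<open>f\<close> then goes to the same
  player if \<open>e\<close> captures, and to the opponent if it does not.\<close>

lemma val_isolated_le:
  assumes "finite U" "f \<in> U" "\<exists>i\<in>I. f \<in> B i" "\<And>i. i \<in> I \<Longrightarrow> f \<in> B i \<Longrightarrow> B i \<inter> U = {f}"
  shows "val U \<le> int (score U f) + val (U - {f})"
  using assms
proof (induction "card U" arbitrary: U rule: less_induct)
  case less
  note iso = less.prems(4)
  \<comment> \<open>No box has both \<open>f\<close> and another undrawn side, so drawing other
    edges does not change the score of \<open>f\<close>, and conversely.\<close>
  have scf: "score W f = card {i \<in> I. f \<in> B i}" if "W \<subseteq> U" "f \<in> W" for W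
    unfolding score_def by (rule arg_cong[where f = card]) (use iso that in blast)
  have sce: "score (U - {f}) e = score U e" if "e \<in> U" "e \<noteq> f" for e
    unfolding score_def by (rule arg_cong[where f = card]) (use iso that in blast)
  have IH: "val (U - {e}) \<le> int (score U f) + val (U - {f} - {e})" if "e \<in> U" "e \<noteq> f" for e
  proof -
    have "val (U - {e}) \<le> int (score (U - {e}) f) + val (U - {e} - {f})"
    proof (rule less.hyps)
      show "card (U - {e}) < card U" using less.prems that by (intro card_Diff1_less)
      show "\<exists>i\<in>I. f \<in> B i" by fact
      show "B i \<inter> (U - {e}) = {f}" if "i \<in> I" "f \<in> B i" for i
        using iso[OF that] \<open>e \<noteq> f\<close> by blast
    qed (use that less.prems(1,2) in auto)
    moreover have "U - {e} - {f} = U - {f} - {e}" by blast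
    ultimately show ?thesis using scf[of U] scf[of "U - {e}"] that less.prems by simp
  qed
  \<comment> \<open>The opposite bound, for the case where the turn passes and the value changes
    sign: the opponent simply captures \<open>f\<close>.\<close>
  have IH': "val (U - {e}) \<ge> int (score U f) + val (U - {f} - {e})" if "e \<in> U" "e \<noteq> f" for e
  proof -
    have *: "score (U - {e}) f > 0"
      unfolding score_pos_iff using less.prems(3) iso that less.prems(2) by blast
    have "val (U - {e}) \<ge> int (score (U - {e}) f) + val (U - {e} - {f})"
      using that less.prems * by (intro val_ge_capture) auto
    moreover have "U - {e} - {f} = U - {f} - {e}" by blast
    ultimately show ?thesis using scf[of U] scf[of "U - {e}"] that less.prems by simp
  qed
  have "U \<noteq> {}" using less.prems by blast
  with \<open>finite U\<close> show ?case
  proof (cases rule: val_attained)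
    case (1 e)
    show ?thesis
    proof (cases "e = f")
      case False
      have "val (U - {f}) \<ge> int (score (U - {f}) e) + val (U - {f} - {e})"
        using 1 False less.prems sce by (intro val_ge_capture) auto
      then show ?thesis using 1 IH[of e] False sce by simp
    qed (use 1 in simp)
  next
    case (2 e)
    have "score U f > 0" unfolding score_pos_iff using less.prems(3) iso by blast
    then have False: "e \<noteq> f" using 2 by auto
    have "val (U - {f}) \<ge> - val (U - {f} - {e})"
      using 2 False less.prems sce by (intro val_ge_pass) auto
    then show ?thesis using 2 IH'[of e] False by simp
  qed
qed

text \<open>
  If the player to move has nothing but \<open>F\<close> to capture and leaves some of it, the opponent takes
  the rest himself.
\<close>

lemma val_pending_le:
  assumes "finite S" "finite F" "S \<inter> F = {}" "val S \<le> 0"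
    and quiet: "\<And>x F'. x \<in> S \<Longrightarrow> F' \<subseteq> F \<Longrightarrow> score (S \<union> F') x = 0"
    and single: "\<And>f F'. F' \<subseteq> F \<Longrightarrow> f \<in> F' \<Longrightarrow> score (S \<union> F') f = 1"
  shows "val (S \<union> F) \<le> int (card F)"
proof -
  \<comment> \<open>Generalised to every remainder \<open>F'\<close>, since the player may capture
    only part of \<open>F\<close> before passing.\<close>
  have "val (S \<union> F') \<le> int (card F')" if "F' \<subseteq> F" for F'
    using finite_subset[OF that \<open>finite F\<close>] that
  proof (induction "card F'" arbitrary: F' rule: less_induct)
    case less
    show ?case
    proof (cases "S \<union> F' = {}")
      case False
      have "finite (S \<union> F')" using less.prems assms by simp
      then show ?thesis using False
      proof (cases rule: val_attained)
        case (1 e)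
        then have e: "e \<in> F'" using quiet[of e F'] less.prems by auto
        then have eq: "S \<union> F' - {e} = S \<union> (F' - {e})" using assms less.prems by blast
        have "val (S \<union> F' - {e}) \<le> int (card (F' - {e}))"
          unfolding eq
        proof (rule less.hyps)
          show "card (F' - {e}) < card F'" using less.prems e by (intro card_Diff1_less)
        qed (use less.prems in auto)
        moreover have "card F' = Suc (card (F' - {e}))"
          using e less.prems by (metis card.remove)
        moreover have "score (S \<union> F') e = 1" using single less.prems e by blast
        ultimately show ?thesis using 1 by linarith
      next
        case (2 e)
        then have e: "e \<in> S" using single[of F' e] less.prems by auto
        \<comment> \<open>The opponent captures all of \<open>F'\<close> and is then to move in
          \<open>S - {e}\<close>, whose value is at least \<open>- val S\<close>, hence
          nonnegative.\<close>
        have "val (S \<union> F' - {e}) \<ge> int (card F') + val (S \<union> F' - {e} - F')"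
        proof (rule val_ge_captures)
          fix f assume f: "f \<in> F'"
          then have "score (S \<union> F') f > 0" using single[of F' f] less.prems by simp
          then obtain i where "i \<in> I" "B i \<inter> (S \<union> F') = {f}" by (auto simp: score_pos_iff)
          moreover have "f \<noteq> e" using e f assms less.prems by blast
          ultimately show "\<exists>i\<in>I. B i \<inter> (S \<union> F' - {e}) = {f}" by blast
        qed (use e less assms in auto)
        moreover have "S \<union> F' - {e} - F' = S - {e}" using assms less.prems by blast
        moreover have "val S \<ge> - val (S - {e})"
          using e assms quiet[of e "{}"] by (intro val_ge_pass) auto
        ultimately show ?thesis using 2 assms by simp
      qed
    qed simp
  qed
  then show ?thesis by blast
qed

end

section \<open>Symmetric positions\<close>

text \<open>\<open>linear\<close> says that two boxes share at most one side.
  \<open>triangle_free\<close> forbids three pairwise adjacent boxes and, with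
  \<open>e = f = g\<close>, an edge in three boxes. By \<open>left_eq\<close> no edge of
  \<open>E\<close> joins the two halves that the reflection exchanges, so \<open>E\<close> must omit
  the middle edge.\<close>

locale mirror_game = box_game I B for I :: "'b set" and B :: "'b \<Rightarrow> 'a set" +
  fixes E :: "'a set" and m :: "'a \<Rightarrow> 'a" and \<mu> :: "'b \<Rightarrow> 'b" and left :: "'b \<Rightarrow> bool"
  assumes linear: "\<lbrakk>i \<in> I; j \<in> I; e \<in> B i; e \<in> B j; f \<in> B i; f \<in> B j; e \<noteq> f\<rbrakk> \<Longrightarrow> i = j"
    and triangle_free: "\<lbrakk>i \<in> I; j \<in> I; k \<in> I; i \<noteq> j; j \<noteq> k; i \<noteq> k; e \<in> B i; e \<in> B j;
      f \<in> B j; f \<in> B k; g \<in> B i; g \<in> B k\<rbrakk> \<Longrightarrow> False"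
    and finite_edges: "finite E"
    and covered: "e \<in> E \<Longrightarrow> \<exists>i\<in>I. e \<in> B i"
    and mirror_mirror: "e \<in> E \<Longrightarrow> m (m e) = e"
    and mirror_box: "i \<in> I \<Longrightarrow> \<mu> i \<in> I"
    and mirror_mirror_box: "i \<in> I \<Longrightarrow> \<mu> (\<mu> i) = i"
    and mirror_in_box: "\<lbrakk>i \<in> I; e \<in> E; e \<in> B i\<rbrakk> \<Longrightarrow> m e \<in> B (\<mu> i)"
    and left_mirror: "i \<in> I \<Longrightarrow> left (\<mu> i) \<longleftrightarrow> \<not> left i"
    and left_eq: "\<lbrakk>i \<in> I; j \<in> I; e \<in> E; e \<in> B i; e \<in> B j\<rbrakk> \<Longrightarrow> left i \<longleftrightarrow> left j"
begin

text \<open>Let \<open>v\<close> be the value once \<open>f\<close> and \<open>g\<close> are both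
  drawn. Taking \<open>f\<close> and then \<open>g\<close> secures \<open>2 + v\<close>. Drawing
  \<open>g\<close> alone passes the turn, by \<open>quiet\<close>, and isolates \<open>f\<close>,
  which then completes just \<open>i\<close> and \<open>j\<close>; this secures
  \<open>- (2 + v)\<close>.\<close>

lemma double_dealing:
  assumes "finite U" "i \<in> I" "j \<in> I" "i \<noteq> j" "B i \<inter> U = {f}" "B j \<inter> U = {f, g}" "f \<noteq> g"
    and quiet: "score U g = 0"
  shows "val U \<ge> 0"
proof -
  \<comment> \<open>Taking the same edge three times in \<open>triangle_free\<close> shows that no
    third box contains \<open>f\<close>.\<close>
  have only: "k = i \<or> k = j" if "k \<in> I" "f \<in> B k" for k
    using triangle_free[of i j k f f f] assms that by blast
  have fU: "f \<in> U" and gU: "g \<in> U" using assms by blast+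
  have "score U f > 0" unfolding score_pos_iff using assms by blast
  then have A1: "val U \<ge> 1 + val (U - {f})"
    using val_ge_capture[of U f] \<open>finite U\<close> fU by linarith
  have "B j \<inter> (U - {f}) = {g}" using assms by blast
  then have "score (U - {f}) g > 0" unfolding score_pos_iff using assms by blast
  then have A2: "val (U - {f}) \<ge> 1 + val (U - {f} - {g})"
    using val_ge_capture[of "U - {f}" g] \<open>finite U\<close> \<open>f \<noteq> g\<close> gU by fastforce
  have B1: "val U \<ge> - val (U - {g})"
    using \<open>finite U\<close> gU quiet by (rule val_ge_pass)
  have "val (U - {g}) \<le> int (score (U - {g}) f) + val (U - {g} - {f})"
  proof (rule val_isolated_le)
    show "B k \<inter> (U - {g}) = {f}" if "k \<in> I" "f \<in> B k" for k
      using only[OF that] assms by auto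
  qed (use assms in auto)
  moreover have "score (U - {g}) f \<le> card {i, j}"
    unfolding score_def by (rule card_mono) (use only in auto)
  moreover have "U - {g} - {f} = U - {f} - {g}" by blast
  ultimately have "val (U - {g}) \<le> 2 + val (U - {f} - {g})" using assms by simp
  then show ?thesis using A1 A2 B1 by linarith
qed

text \<open>With no capture on offer the first move \<open>e\<close> passes the turn, so it suffices
  that the other player has a nonnegative value afterwards (\<open>reply\<close>). The induction is
  applied to the symmetric remainder \<open>S\<close>.\<close>

lemma symmetric_val_le_0:
  assumes "P \<subseteq> E" "m ` P \<subseteq> P" "\<And>i f. i \<in> I \<Longrightarrow> B i \<inter> P \<noteq> {f}"
  shows "val P \<le> 0"
  using assms
proof (induction "card P" arbitrary: P rule: less_induct)
  case less
  note sub = less.prems(1) and sym = less.prems(2) and free = less.prems(3)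
  have finP: "finite P" using sub finite_edges finite_subset by blast
  have reply: "val (P - {e}) \<ge> 0" if e: "e \<in> P" for e
  proof -
    let ?R = "P - {e}"
    \<comment> \<open>The captures opened by \<open>e\<close>. Since \<open>P\<close> offers none, a
      box captured by \<open>f \<in> K\<close> has exactly the undrawn sides \<open>e\<close> and
      \<open>f\<close> in \<open>P\<close>.\<close>
    define K where "K = {f \<in> ?R. \<exists>i\<in>I. B i \<inter> ?R = {f}}"
    have KI: "\<exists>i\<in>I. B i \<inter> P = {e, f} \<and> e \<in> B i \<and> f \<in> B i" if f: "f \<in> K" for f
    proof -
      obtain i where i: "i \<in> I" "B i \<inter> ?R = {f}" using f unfolding K_def by blast
      have "B i \<inter> P \<noteq> {f}" using free i(1) by simp
      then have "B i \<inter> P = {e, f}" using i(2) e by blast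
      moreover have "e \<in> B i" "f \<in> B i" using calculation by blast+
      ultimately show ?thesis using i(1) by blast
    qed
    show ?thesis
    \<comment> \<open>Does some capture lead on into a box with two undrawn sides? If so, double
      dealing applies.\<close>
    proof (cases "\<exists>f\<in>K. \<exists>i\<in>I. \<exists>j\<in>I. B i \<inter> ?R = {f} \<and> i \<noteq> j \<and> f \<in> B j \<and> card (B j \<inter> ?R) = 2")
      case True
      then obtain f i j where fij: "f \<in> K" "i \<in> I" "j \<in> I" "B i \<inter> ?R = {f}" "i \<noteq> j" "f \<in> B j"
        "card (B j \<inter> ?R) = 2" by blast
      have "f \<in> B j \<inter> ?R" using fij(1,6) by (simp add: K_def)
      then obtain g where g: "B j \<inter> ?R = {f, g}" "f \<noteq> g"
        using card_2_other fij(7) by metis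
      have ei: "e \<in> B i" using free[OF fij(2), of f] fij(4) by blast
      \<comment> \<open>If \<open>g\<close> were capturable too, its box \<open>d\<close> would
        contain \<open>e\<close>, and \<open>i\<close>, \<open>j\<close>, \<open>d\<close> would
        share \<open>e\<close>, \<open>f\<close>, \<open>g\<close> pairwise.\<close>
      have "score ?R g = 0"
      proof (rule ccontr)
        assume "score ?R g \<noteq> 0"
        then obtain d where d: "d \<in> I" "B d \<inter> ?R = {g}" unfolding score_eq_0_iff by blast
        then have "e \<in> B d" using free[OF d(1), of g] by blast
        moreover have "d \<noteq> i" using d(2) fij(4) g(2) by (metis singleton_inject)
        moreover have "d \<noteq> j" using d(2) g by (metis insertI1 singletonD)
        moreover have "f \<in> B i" using fij(4) by blast
        moreover have "g \<in> B j" using g(1) by blast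
        moreover have "g \<in> B d" using d(2) by blast
        ultimately show False
          using triangle_free[OF fij(2,3) d(1) fij(5), of f g e] ei fij(6) by metis
      qed
      then show ?thesis
        by (rule double_dealing[OF finite_Diff[OF finP] fij(2,3,5,4) g])
    next
      case False
      \<comment> \<open>\<open>A\<close> consists of \<open>e\<close> and the captures answering it,
        \<open>A'\<close> is its mirror image, and \<open>S\<close> is what remains without
        both.\<close>
      define A where "A = insert e K"
      define A' where "A' = m ` A"
      define S where "S = P - A - A'"
      have AP: "A \<subseteq> P" using e by (auto simp: A_def K_def)
      have A'P: "A' \<subseteq> P" using AP sym by (auto simp: A'_def)
      have eK: "e \<notin> K" by (simp add: K_def)
      have mPm: "m (m x) = x" if "x \<in> P" for x using that sub mirror_mirror by blast
      have mirror_side: "B (\<mu> d) \<inter> P = m ` (B d \<inter> P)" if d: "d \<in> I" for d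
      proof
        show "m ` (B d \<inter> P) \<subseteq> B (\<mu> d) \<inter> P" using d mirror_in_box sub sym by blast
        show "B (\<mu> d) \<inter> P \<subseteq> m ` (B d \<inter> P)"
        proof
          fix x assume x: "x \<in> B (\<mu> d) \<inter> P"
          then have "m x \<in> B (\<mu> (\<mu> d))" using mirror_in_box[of "\<mu> d" x] mirror_box d sub by blast
          then have "m x \<in> B d \<inter> P" using x sym d mirror_mirror_box by auto
          then show "x \<in> m ` (B d \<inter> P)" using mPm[of x] x by (metis IntD2 image_eqI)
        qed
      qed
      \<comment> \<open>Drawing \<open>A\<close> leaves no capture: a box is finished off by
        \<open>e\<close> and one \<open>f\<close>, was already complete, or keeps two undrawn
        sides.\<close>
      have trich: "(\<exists>f\<in>K. B d \<inter> P = {e, f}) \<or> B d \<inter> P = {} \<or> card (B d \<inter> (P - A)) \<ge> 2"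
        if d: "d \<in> I" for d
      proof (cases "B d \<inter> P = {}")
        case ne: False
        have fd: "finite (B d \<inter> P)" using finP by blast
        have c2: "card (B d \<inter> P) \<ge> 2"
        proof -
          have "card (B d \<inter> P) \<noteq> 0" using ne fd by simp
          moreover have "card (B d \<inter> P) \<noteq> 1" using free[OF d] by (metis card_1_singletonE)
          ultimately show ?thesis by linarith
        qed
        show ?thesis
        proof (cases "e \<in> B d")
          case ed: True
          show ?thesis
          proof (cases "card (B d \<inter> P) = 2")
            case True
            then obtain f where f: "B d \<inter> P = {e, f}" "e \<noteq> f"
              using card_2_other[of "B d \<inter> P" e] ed e by auto
            then have "B d \<inter> ?R = {f}" "f \<in> ?R" by blast+
            then have "f \<in> K" using d unfolding K_def by blast
            then show ?thesis using f by blast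
          next
            case n2: False
            \<comment> \<open>By \<open>linear\<close> a box containing \<open>e\<close> and some
              \<open>f \<in> K\<close> is the one captured by \<open>f\<close>, which has only two
              undrawn sides in \<open>P\<close>.\<close>
            have "f \<notin> B d" if f: "f \<in> K" for f
            proof
              assume fd: "f \<in> B d"
              obtain i where i: "i \<in> I" "B i \<inter> P = {e, f}" "e \<in> B i" "f \<in> B i"
                using KI[OF f] by blast
              have "e \<noteq> f" using f eK by metis
              then have "i = d" using linear[OF i(1) d i(3) ed i(4) fd] by simp
              then show False using n2 i(2) \<open>e \<noteq> f\<close> by simp
            qed
            then have "B d \<inter> (P - A) = (B d \<inter> P) - {e}"
              unfolding A_def by blast
            moreover have "e \<in> B d \<inter> P" using ed e by simp
            ultimately have "card (B d \<inter> (P - A)) = card (B d \<inter> P) - 1"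
              by (simp only: card_Diff_singleton)
            then show ?thesis using n2 c2 by linarith
          qed
        next
          case ned: False
          show ?thesis
          proof (cases "\<exists>f\<in>K. f \<in> B d")
            case no: False
            then have "B d \<inter> (P - A) = B d \<inter> P" using ned by (auto simp: A_def)
            then show ?thesis using c2 by simp
          next
            case True
            then obtain f where f: "f \<in> K" "f \<in> B d" by blast
            obtain i where i: "i \<in> I" "B i \<inter> P = {e, f}" "e \<in> B i" "f \<in> B i"
              using KI[OF f(1)] by blast
            have id: "i \<noteq> d" using i(3) ned by metis
            have "f \<noteq> e" using f(1) eK by metis
            then have "B i \<inter> ?R = {f}" using i(2) by blast
            moreover have "B d \<inter> ?R = B d \<inter> P" using ned by blast
            \<comment> \<open>Exactly two undrawn sides here would be the double dealing
              case.\<close>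
            ultimately have n2: "card (B d \<inter> P) \<noteq> 2" using False f i(1) d id by metis
            \<comment> \<open>Two edges of \<open>K\<close> in \<open>d\<close> would make
              \<open>d\<close> and their captured boxes, which share \<open>e\<close>, a
              triangle.\<close>
            have "f2 = f" if f2: "f2 \<in> K" "f2 \<in> B d" for f2
            proof (rule ccontr)
              assume neq: "f2 \<noteq> f"
              obtain i2 where i2: "i2 \<in> I" "B i2 \<inter> P = {e, f2}" "e \<in> B i2" "f2 \<in> B i2"
                using KI[OF f2(1)] by blast
              have "i2 \<noteq> d" using i2(3) ned by metis
              moreover have "i \<noteq> i2" using neq i(2) i2(2) by (metis doubleton_eq_iff)
              ultimately show False
                using triangle_free[OF i(1) i2(1) d _ _ id i(3) i2(3,4) f2(2) i(4) f(2)] by blast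
            qed
            then have "B d \<inter> (P - A) = (B d \<inter> P) - {f}"
              using ned f unfolding A_def by blast
            moreover have "f \<in> B d \<inter> P" using f by (simp add: K_def)
            ultimately have "card (B d \<inter> (P - A)) = card (B d \<inter> P) - 1"
              by (simp only: card_Diff_singleton)
            then show ?thesis using n2 c2 by linarith
          qed
        qed
      qed blast
      have mcard: "card (m ` X) = card X" if "X \<subseteq> P" for X
        using that mPm by (intro card_image inj_onI) (metis subsetD)
      have trich': "(\<exists>f\<in>m ` K. B d \<inter> P = {m e, f}) \<or> B d \<inter> P = {} \<or> card (B d \<inter> (P - A')) \<ge> 2"
        if d: "d \<in> I" for d
      proof -
        have eq: "B d \<inter> P = m ` (B (\<mu> d) \<inter> P)"
          using mirror_side[of "\<mu> d"] mirror_box mirror_mirror_box d by simp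
        have "B d \<inter> (P - A') = (B d \<inter> P) - m ` A" by (auto simp: A'_def)
        also have "\<dots> = m ` ((B (\<mu> d) \<inter> P) - A)"
          unfolding eq using mPm AP by (auto simp: image_iff) (metis subsetD)
        also have "(B (\<mu> d) \<inter> P) - A = B (\<mu> d) \<inter> (P - A)" by blast
        finally have "card (B d \<inter> (P - A')) = card (B (\<mu> d) \<inter> (P - A))"
          using mcard[of "B (\<mu> d) \<inter> (P - A)"] by auto
        then show ?thesis using trich[of "\<mu> d"] mirror_box d eq by auto
      qed
      \<comment> \<open>Every edge of \<open>A\<close> shares a box with \<open>e\<close>, so all
        boxes meeting \<open>A\<close> lie in one half. Hence no box meets both \<open>A\<close> and
        \<open>A'\<close>.\<close>
      have Aside: "left i \<longleftrightarrow> left j"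
        if a: "a \<in> A" and i: "i \<in> I" "a \<in> B i" and j: "j \<in> I" "e \<in> B j" for a i j
      proof (cases "a = e")
        case True
        then show ?thesis using left_eq[OF i(1) j(1), of e] i j e sub by blast
      next
        case False
        then have "a \<in> K" using a by (simp add: A_def)
        then obtain k where k: "k \<in> I" "e \<in> B k" "a \<in> B k" using KI by blast
        have "a \<in> E" "e \<in> E" using AP a e sub by auto
        then show ?thesis using left_eq[of i k a] left_eq[of k j e] i j k by metis
      qed
      obtain j0 where j0: "j0 \<in> I" "e \<in> B j0" using covered e sub by blast
      have apart: "B d \<inter> A = {} \<or> B d \<inter> A' = {}" if d: "d \<in> I" for d
      proof (rule ccontr)
        assume "\<not> ?thesis"
        then obtain a a' where a: "a \<in> A" "a \<in> B d" "a' \<in> A" "m a' \<in> B d" by (auto simp: A'_def)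
        have "m a' \<in> E" using a AP sym sub by blast
        then have "m (m a') \<in> B (\<mu> d)" using mirror_in_box[of d "m a'"] a d by blast
        then have "a' \<in> B (\<mu> d)" using mPm AP a by auto
        then have "left (\<mu> d) = left j0" using Aside[of a' "\<mu> d" j0] a j0 mirror_box d by blast
        moreover have "left d = left j0" using Aside[of a d j0] a j0 d by blast
        ultimately show False using left_mirror d by blast
      qed
      have disj: "A \<inter> A' = {}"
        using apart covered AP sub by blast
      have e'A': "m e \<in> A'" by (simp add: A'_def A_def)
      have KA': "m ` K \<subseteq> A'" by (auto simp: A'_def A_def)
      have e'K: "m e \<notin> m ` K"
        using mPm e eK AP by (metis A_def imageE insertCI subsetD)
      have finK: "finite K" using finP by (simp add: K_def)
      have cardK: "card (m ` K) = card K" using mcard[of K] by (auto simp: K_def)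
      \<comment> \<open>The reply: capture all of \<open>K\<close>, then pass the turn by drawing
        \<open>m e\<close>.\<close>
      have "val ?R \<ge> int (card K) + val (?R - K)"
        using finK finP by (intro val_ge_captures) (auto simp: K_def)
      moreover have "?R - K = P - A" by (auto simp: A_def)
      moreover have "val (P - A) \<ge> - val (P - A - {m e})"
      proof (rule val_ge_pass)
        show "finite (P - A)" using finP by simp
        show "m e \<in> P - A" using e'A' A'P disj by blast
        \<comment> \<open>A box containing \<open>m e\<close> is untouched by \<open>A\<close>, so a
          capture there would already exist in \<open>P\<close>.\<close>
        show "score (P - A) (m e) = 0"
          unfolding score_eq_0_iff
        proof (intro ballI notI)
          fix d assume d: "d \<in> I" "B d \<inter> (P - A) = {m e}"
          then have "B d \<inter> A = {}" using apart[of d] e'A' by blast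
          then show False using d free[of d "m e"] by blast
        qed
      qed
      moreover have "P - A - {m e} = S \<union> m ` K"
        using A'P disj e'K unfolding S_def A'_def A_def by auto
      \<comment> \<open>The opponent can win back at most the mirrored captures, and these cancel
        the \<open>card K\<close> just gained.\<close>
      moreover have "val (S \<union> m ` K) \<le> int (card (m ` K))"
      proof (rule val_pending_le)
        have shape: "(\<exists>f\<in>F'. B d \<inter> (S \<union> F') = {f} \<and> B d \<inter> P = {m e, f})
            \<or> B d \<inter> (S \<union> F') = {} \<or> card (B d \<inter> (S \<union> F')) \<ge> 2"
          if d: "d \<in> I" and F': "F' \<subseteq> m ` K" for d F'
        proof (cases "B d \<inter> A' = {}")
          case True
          have eq: "B d \<inter> (S \<union> F') = B d \<inter> (P - A)"
            using True F' KA' unfolding S_def by blast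
          show ?thesis using trich[OF d]
          proof (elim disjE bexE)
            fix f assume "f \<in> K" "B d \<inter> P = {e, f}"
            then have "B d \<inter> (P - A) = {}" unfolding A_def by blast
            then show ?thesis unfolding eq by blast
          next
            assume "B d \<inter> P = {}"
            then have "B d \<inter> (P - A) = {}" by blast
            then show ?thesis unfolding eq by blast
          next
            assume "card (B d \<inter> (P - A)) \<ge> 2"
            then show ?thesis unfolding eq by blast
          qed
        next
          case n: False
          then have dA: "B d \<inter> A = {}" using apart[OF d] by blast
          have F'P: "F' \<subseteq> P" using F' KA' A'P by (meson subset_trans)
          have eq: "B d \<inter> (S \<union> F') = B d \<inter> (P - A') \<union> B d \<inter> F'"
            using dA unfolding S_def by blast
          show ?thesis using trich'[OF d]
          proof (elim disjE bexE)
            fix f assume f: "f \<in> m ` K" "B d \<inter> P = {m e, f}"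
            have "f \<in> A'" using f(1) KA' by (rule subsetD[rotated])
            moreover have "B d \<inter> (P - A') = {m e, f} - A'"
              unfolding f(2)[symmetric] by blast
            ultimately have "B d \<inter> (P - A') = {}" using e'A' by simp
            have "m e \<notin> F'" using F' e'K by (meson subsetD)
            moreover have "B d \<inter> F' = {m e, f} \<inter> F'"
              unfolding f(2)[symmetric] using F'P by blast
            ultimately have "B d \<inter> F' = {f} \<inter> F'" by simp
            with \<open>B d \<inter> (P - A') = {}\<close> have "B d \<inter> (S \<union> F') = {f} \<inter> F'" using eq by simp
            then show ?thesis using f(2) by (cases "f \<in> F'") auto
          next
            assume "B d \<inter> P = {}"
            then have "B d \<inter> (S \<union> F') = {}" unfolding eq using F'P by blast
            then show ?thesis by blast
          next
            assume "card (B d \<inter> (P - A')) \<ge> 2"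
            moreover have "finite (B d \<inter> (S \<union> F'))"
              using finite_subset[OF F'P finP] finP by (simp add: S_def)
            then have "card (B d \<inter> (P - A')) \<le> card (B d \<inter> (S \<union> F'))"
              by (rule card_mono) (simp add: eq)
            ultimately show ?thesis by linarith
          qed
        qed
        show "finite S" "finite (m ` K)" using finP finK by (auto simp: S_def)
        show disjS: "S \<inter> m ` K = {}" using KA' by (auto simp: S_def)
        show quiet: "score (S \<union> F') x = 0" if "x \<in> S" "F' \<subseteq> m ` K" for x F'
          unfolding score_eq_0_iff
        proof (intro ballI notI)
          fix d assume d: "d \<in> I" "B d \<inter> (S \<union> F') = {x}"
          then have "x \<in> F'" using shape[OF d(1) that(2)] by auto
          then show False using that disjS by blast
        qed
        show "score (S \<union> F') f = 1" if F': "F' \<subseteq> m ` K" "f \<in> F'" for F' f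
        proof -
          obtain f0 where f0: "f0 \<in> K" "f = m f0" using F' by blast
          obtain i where i: "i \<in> I" "B i \<inter> P = {e, f0}" using KI f0 by blast
          have iP: "B (\<mu> i) \<inter> P = {m e, f}" using mirror_side[OF i(1)] i f0 by simp
          have "\<mu> i \<in> I" using mirror_box i by blast
          have ef: "m e \<noteq> f" using e'K F' by blast
          have "m e \<notin> S \<union> F'" using e'K F' e'A' by (auto simp: S_def)
          moreover have "S \<union> F' \<subseteq> P" using F' KA' A'P by (auto simp: S_def)
          then have "B (\<mu> i) \<inter> (S \<union> F') = {m e, f} \<inter> (S \<union> F')"
            unfolding iP[symmetric] by blast
          ultimately have iS: "B (\<mu> i) \<inter> (S \<union> F') = {f}" using F'(2) by simp
          \<comment> \<open>Such a box has \<open>m e\<close> and \<open>f\<close> as sides, so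
            \<open>linear\<close> leaves only the mirror image of the box captured by
            \<open>f0\<close>.\<close>
          have "{d \<in> I. B d \<inter> (S \<union> F') = {f}} = {\<mu> i}"
          proof
            show "{d \<in> I. B d \<inter> (S \<union> F') = {f}} \<subseteq> {\<mu> i}"
            proof
              fix d assume "d \<in> {d \<in> I. B d \<inter> (S \<union> F') = {f}}"
              then have d: "d \<in> I" "B d \<inter> (S \<union> F') = {f}" by auto
              then have "B d \<inter> P = {m e, f}" using shape[OF d(1) F'(1)] by auto
              then have "m e \<in> B d" "f \<in> B d" by blast+
              moreover have "m e \<in> B (\<mu> i)" "f \<in> B (\<mu> i)" using iP by blast+
              ultimately have "d = \<mu> i"
                using linear d(1) ef \<open>\<mu> i \<in> I\<close> by metis
              then show "d \<in> {\<mu> i}" by simp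
            qed
          qed (use iS \<open>\<mu> i \<in> I\<close> in blast)
          then show ?thesis by (simp add: score_def)
        qed
        show "val S \<le> 0"
        proof (rule less.hyps)
          show "card S < card P"
            using finP e by (intro psubset_card_mono) (auto simp: S_def A_def)
          show "S \<subseteq> E" using sub by (auto simp: S_def)
          show "m ` S \<subseteq> S"
          proof
            fix y assume "y \<in> m ` S"
            then obtain x where x: "x \<in> P" "x \<notin> A" "x \<notin> A'" "y = m x" by (auto simp: S_def)
            have "m x \<notin> A" using x mPm by (metis A'_def imageI)
            moreover have "m x \<notin> A'" using x mPm AP unfolding A'_def by (metis imageE subsetD)
            ultimately show "y \<in> S" using x sym by (auto simp: S_def)
          qed
          \<comment> \<open>With no pending captures, \<open>F' = {}\<close>, the first alternative
            of \<open>shape\<close> disappears.\<close>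
          show "B i \<inter> S \<noteq> {f}" if "i \<in> I" for i f
            using shape[OF that, of "{}"] by auto
        qed
      qed
      ultimately show ?thesis using cardK by simp
    qed
  qed
  show ?case
  proof (cases "P = {}")
    case False
    with finP show ?thesis
    proof (cases rule: val_attained)
      case (1 e)
      then show ?thesis using free by (auto simp: score_pos_iff)
    next
      case (2 e)
      then show ?thesis using reply[of e] by simp
    qed
  qed simp
qed

end

section \<open>The board\<close>

interpretation board: box_game "{1..n}" box_sides for n :: nat
  by unfold_locales simp

lemma box_sides_subset: "i \<in> {1..n} \<Longrightarrow> box_sides i \<subseteq> board_edges n"
  by (auto simp: box_sides_def board_edges_def)

lemma finite_board_edges [simp]: "finite (board_edges n)"
  by (simp add: board_edges_def)

lemma completed_eq_score:
  assumes "e \<in> U"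
  shows "completed n (board_edges n - U) e = board.score n U e"
proof -
  have "e \<in> box_sides i \<and> box_sides i \<subseteq> insert e (board_edges n - U) \<longleftrightarrow> box_sides i \<inter> U = {e}"
    if "i \<in> {1..n}" for i
    using box_sides_subset[OF that] assms by blast
  then show ?thesis
    unfolding completed_def board.score_def by (simp cong: conj_cong)
qed

text \<open>The final lead \<open>s + val\<close> (or \<open>s - val\<close> on the second player's
  turn) is an invariant lower bound: a move attaining the maximum preserves it, and no move of the
  opponent decreases it.\<close>

lemma first_can_force_if_val:
  assumes "U \<subseteq> board_edges n"
  shows "(s + board.val n U \<ge> 0 \<longrightarrow> first_can_force n (board_edges n - U) s True) \<and>
    (s - board.val n U \<ge> 0 \<longrightarrow> first_can_force n (board_edges n - U) s False)"
  using assms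
proof (induction "card U" arbitrary: U s rule: less_induct)
  case less
  let ?D = "board_edges n - U"
  have fin: "finite U" using less.prems finite_board_edges finite_subset by blast
  have Un: "board_edges n - ?D = U" using less.prems by blast
  have ins: "insert e ?D = board_edges n - (U - {e})" if "e \<in> U" for e
    using that less.prems by blast
  have IH: "(s + board.val n (U - {e}) \<ge> 0 \<longrightarrow> first_can_force n (insert e ?D) s True) \<and>
    (s - board.val n (U - {e}) \<ge> 0 \<longrightarrow> first_can_force n (insert e ?D) s False)" if "e \<in> U" for e s
    unfolding ins[OF that]
  proof (rule less.hyps)
    show "card (U - {e}) < card U" using fin that by (intro card_Diff1_less)
  qed (use less.prems in blast)
  note sc = completed_eq_score[of _ U n]
  show ?case
  proof (cases "U = {}")
    case True
    then show ?thesis using board.val_empty[of n] by (auto intro: first_can_force.game_over)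
  next
    case False
    have "first_can_force n ?D s True" if s: "s + board.val n U \<ge> 0"
      using fin False
    proof (cases rule: board.val_attained[of U n])
      case (1 e)
      show ?thesis
      proof (rule first_can_force.first_moves)
        show "e \<in> board_edges n - ?D" using 1 Un by simp
        show "first_can_force n (insert e ?D) (s + int (completed n ?D e)) (completed n ?D e > 0)"
          using IH[of e "s + int (board.score n U e)"] 1 s by (simp add: sc)
      qed
    next
      case (2 e)
      show ?thesis
      proof (rule first_can_force.first_moves)
        show "e \<in> board_edges n - ?D" using 2 Un by simp
        show "first_can_force n (insert e ?D) (s + int (completed n ?D e)) (completed n ?D e > 0)"
          using IH[of e s] 2 s by (simp add: sc)
      qed
    qed
    moreover have "first_can_force n ?D s False" if s: "s - board.val n U \<ge> 0"
    proof (rule first_can_force.second_moves)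
      show "board_edges n - ?D \<noteq> {}" using Un False by simp
      show "\<forall>e\<in>board_edges n - ?D. first_can_force n (insert e ?D)
        (s - int (completed n ?D e)) (completed n ?D e = 0)"
        unfolding Un
      proof
        fix e assume e: "e \<in> U"
        show "first_can_force n (insert e ?D) (s - int (completed n ?D e)) (completed n ?D e = 0)"
        proof (cases "board.score n U e = 0")
          case True
          then show ?thesis using board.val_ge_pass[OF fin e True] IH[OF e, of s] s
            by (simp add: sc e)
        next
          case n: False
          then show ?thesis using board.val_ge_capture[OF fin e, of n] s
              IH[OF e, of "s - int (board.score n U e)"]
            by (simp add: sc e)
        qed
      qed
    qed
    ultimately show ?thesis by blast
  qed
qed

section \<open>Incidence of sides and boxes, and the reflection of the board\<close>

fun mirror_edge :: "nat \<Rightarrow> edge \<Rightarrow> edge" where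
  "mirror_edge n (BotE i) = BotE (n + 1 - i)"
| "mirror_edge n (TopE i) = TopE (n + 1 - i)"
| "mirror_edge n (VertE i) = VertE (n - i)"

lemma mem_box_sides_iff:
  "BotE k \<in> box_sides i \<longleftrightarrow> k = i"
  "TopE k \<in> box_sides i \<longleftrightarrow> k = i"
  "VertE k \<in> box_sides i \<longleftrightarrow> k = i - 1 \<or> k = i"
  by (auto simp: box_sides_def)

lemma mem_board_edges_iff:
  "BotE k \<in> board_edges n \<longleftrightarrow> 1 \<le> k \<and> k \<le> n"
  "TopE k \<in> board_edges n \<longleftrightarrow> 1 \<le> k \<and> k \<le> n"
  "VertE k \<in> board_edges n \<longleftrightarrow> k \<le> n"
  by (auto simp: board_edges_def)

lemma common_side:
  assumes "i \<ge> 1" "j \<ge> 1" "i \<noteq> j" "e \<in> box_sides i" "e \<in> box_sides j"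
  shows "e = VertE (min i j)" "j = i + 1 \<or> i = j + 1"
  using assms by (cases e; auto simp: mem_box_sides_iff)+

text \<open>Boxes sharing a side are neighbours with a single common wall, which gives
  \<open>linear\<close> and \<open>triangle_free\<close>. Boxes are numbered from 1 and walls from
  0, hence \<open>n + 1 - i\<close> against \<open>n - i\<close>. Evenness matters: for odd
  \<open>n\<close> the middle box would be its own mirror image.\<close>

lemma mirror_game_board:
  assumes "even n"
  shows "mirror_game {1..n} box_sides (board_edges n - {VertE (n div 2)}) (mirror_edge n)
    (\<lambda>i. n + 1 - i) (\<lambda>i. i \<le> n div 2)"
proof
  fix i j e f
  assume "i \<in> {1..n}" "j \<in> {1..n}" "e \<in> box_sides i" "e \<in> box_sides j"
    "f \<in> box_sides i" "f \<in> box_sides j" "e \<noteq> f"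
  then show "i = j" using common_side(1)[of i j e] common_side(1)[of i j f] by force
next
  fix i j k e f g
  assume "i \<in> {1..n}" "j \<in> {1..n}" "k \<in> {1..n}" "i \<noteq> j" "j \<noteq> k" "i \<noteq> k"
    "e \<in> box_sides i" "e \<in> box_sides j" "f \<in> box_sides j" "f \<in> box_sides k"
    "g \<in> box_sides i" "g \<in> box_sides k"
  then show False
    using common_side(2)[of i j e] common_side(2)[of j k f] common_side(2)[of i k g] by force
next
  fix e
  assume e: "e \<in> board_edges n - {VertE (n div 2)}"
  show "\<exists>i\<in>{1..n}. e \<in> box_sides i"
  proof (cases e)
    case (VertE k)
    show ?thesis
    proof (cases "k = 0")
      case True
      \<comment> \<open>Box 1 exists, since for \<open>n = 0\<close> the edge \<open>VertE 0\<close>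
        would be the removed middle edge.\<close>
      then show ?thesis using e VertE assms by (intro bexI[of _ 1]) (auto simp: mem_box_sides_iff elim: evenE)
    next
      case False
      then show ?thesis using e VertE by (auto simp: mem_box_sides_iff mem_board_edges_iff)
    qed
  qed (use e in \<open>auto simp: mem_box_sides_iff mem_board_edges_iff\<close>)
  show "mirror_edge n (mirror_edge n e) = e"
    using e by (cases e) (auto simp: mem_board_edges_iff)
next
  fix i e
  assume "i \<in> {1..n}" "e \<in> board_edges n - {VertE (n div 2)}" "e \<in> box_sides i"
  then show "mirror_edge n e \<in> box_sides (n + 1 - i)"
    by (cases e) (auto simp: mem_box_sides_iff mem_board_edges_iff)
next
  fix i j e
  assume "i \<in> {1..n}" "j \<in> {1..n}" "e \<in> board_edges n - {VertE (n div 2)}"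
    "e \<in> box_sides i" "e \<in> box_sides j"
  then show "i \<le> n div 2 \<longleftrightarrow> j \<le> n div 2"
    by (cases e) (auto simp: mem_box_sides_iff)
qed (use assms in \<open>auto elim!: evenE\<close>)

text \<open>Common to both starts. By \<open>two\<close> the opening in the middle captures nothing
  and exposes no box; by \<open>sym\<close> the opponent then faces a symmetric position of value at
  most 0.\<close>

lemma first_can_force_symmetric:
  assumes "even n" "D \<subseteq> board_edges n" "VertE (n div 2) \<notin> D"
    and sym: "\<And>e. e \<in> board_edges n \<Longrightarrow> mirror_edge n e \<in> D \<Longrightarrow> e \<in> D"
    and two: "\<And>i. i \<in> {1..n} \<Longrightarrow> \<exists>e f. e \<noteq> f \<and>
      {e, f} \<subseteq> box_sides i - D - {VertE (n div 2)}"
  shows "first_can_force n D 0 True"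
proof -
  interpret mirror_game "{1..n}" box_sides "board_edges n - {VertE (n div 2)}" "mirror_edge n"
    "\<lambda>i. n + 1 - i" "\<lambda>i. i \<le> n div 2"
    using mirror_game_board \<open>even n\<close> .
  obtain h where h: "n = 2 * h" using \<open>even n\<close> by (rule evenE)
  let ?c = "VertE (n div 2)"
  let ?U = "board_edges n - D"
  have free: "box_sides i \<inter> (?U - {?c}) \<noteq> {g}" "box_sides i \<inter> ?U \<noteq> {?c}"
    if i: "i \<in> {1..n}" for i g
  proof -
    obtain e f where ef: "e \<noteq> f" "{e, f} \<subseteq> box_sides i - D - {?c}"
      using two[OF i] by blast
    have mem: "x \<in> box_sides i \<inter> (?U - {?c})" if "x \<in> {e, f}" for x
      using subsetD[OF ef(2) that] subsetD[OF box_sides_subset[OF i], of x] by simp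
    show "box_sides i \<inter> (?U - {?c}) \<noteq> {g}"
      using mem[of e] mem[of f] ef(1) by (metis insertCI singletonD)
    show "box_sides i \<inter> ?U \<noteq> {?c}"
      using mem[of e] by (metis DiffD1 DiffD2 IntD1 IntD2 IntI insertCI singletonD)
  qed
  have "board.val n (?U - {?c}) \<le> 0"
  proof (rule symmetric_val_le_0)
    show "mirror_edge n ` (?U - {?c}) \<subseteq> ?U - {?c}"
    proof
      fix y assume "y \<in> mirror_edge n ` (?U - {?c})"
      then obtain x where x: "x \<in> board_edges n" "x \<notin> D" "x \<noteq> ?c" "y = mirror_edge n x" by blast
      have "y \<notin> D" using sym x by blast
      moreover have "y \<in> board_edges n"
        using x by (cases x) (auto simp: mem_board_edges_iff)
      moreover have "y \<noteq> ?c"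
        using x h by (cases x) (auto simp: mem_board_edges_iff)
      ultimately show "y \<in> ?U - {?c}" by blast
    qed
    show "box_sides i \<inter> (?U - {?c}) \<noteq> {f}" if "i \<in> {1..n}" for i f
      using free(1)[OF that] .
  qed blast
  moreover have "board.val n ?U \<ge> - board.val n (?U - {?c})"
  proof (rule board.val_ge_pass)
    show "board.score n ?U ?c = 0" unfolding board.score_eq_0_iff
      using free(2) by blast
  qed (use assms(3) in \<open>auto simp: mem_board_edges_iff\<close>)
  ultimately have "0 + board.val n ?U \<ge> 0" by linarith
  moreover have "board_edges n - ?U = D" using assms(2) by blast
  ultimately show ?thesis using first_can_force_if_val[of ?U n 0] by simp
qed

theorem theorem2:
  fixes n :: nat
  assumes "even n" and "n \<ge> 4"
  shows "first_can_force n (open_start n) 0 True \<and> first_can_force n (closed_start n) 0 True"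
proof
  show "first_can_force n (open_start n) 0 True"
  proof (rule first_can_force_symmetric)
    fix i assume "i \<in> {1..n}"
    show "\<exists>e f. e \<noteq> f \<and> {e, f} \<subseteq> box_sides i - open_start n - {VertE (n div 2)}"
      by (rule exI[of _ "BotE i"], rule exI[of _ "TopE i"]) (simp add: box_sides_def open_start_def)
  qed (use assms in \<open>auto simp: open_start_def\<close>)
  show "first_can_force n (closed_start n) 0 True"
  proof (rule first_can_force_symmetric)
    fix i assume i: "i \<in> {1..n}"
    \<comment> \<open>Besides \<open>BotE i\<close>, each box needs an undrawn wall other than the
      middle one. For \<open>i = n div 2\<close> this is \<open>i - 1\<close>, and
      \<open>n \<ge> 4\<close> ensures that it is not the drawn side \<open>VertE 0\<close>.\<close>
    have "\<exists>k. k \<in> {i - 1, i} \<and> k \<notin> {0, n div 2, n}"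
    proof (cases "i \<in> {n div 2, n}")
      case True
      then show ?thesis using assms i by (intro exI[of _ "i - 1"]) auto
    next
      case False
      then show ?thesis using i by (intro exI[of _ i]) auto
    qed
    then obtain k where "k \<in> {i - 1, i}" "k \<notin> {0, n div 2, n}" by blast
    then show "\<exists>e f. e \<noteq> f \<and> {e, f} \<subseteq> box_sides i - closed_start n - {VertE (n div 2)}"
      by (intro exI[of _ "BotE i"] exI[of _ "VertE k"]) (auto simp: box_sides_def closed_start_def)
  next
    fix e assume "e \<in> board_edges n" "mirror_edge n e \<in> closed_start n"
    then show "e \<in> closed_start n"
      by (cases e) (auto simp: closed_start_def mem_board_edges_iff image_iff)
  qed (use assms in \<open>auto simp: closed_start_def board_edges_def\<close>)
qed

end
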